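(* Let $c_1,c_2,\delta>0$. Model GL, i.e. the iteration map $$x_1(t+1)=x_1(t)+\delta\,G_1(x_1(t),x_2(t)),\qquad x_2(t+1)=\frac{2x_2(t)+x_1(t)}{2\left(1+c_2(x_1(t)+x_2(t))^2\right)},$$ has a unique equilibrium $(x_1,x_2)$ with $x_1,x_2>0$. This equilibrium is locally stable if $R_{GL}^1<0$, where \begin{align*} R_{GL}^1=\,&64\,c_1^7c_2\delta^4-672\,c_1^6c_2^2\delta^4+1796\,c_1^5c_2^3\delta^4-168\,c_1^4c_2^4\delta^4+4\,c_1^3c_2^5\delta^4+384\,c_1^6c_2\delta^2\\ &-400\,c_1^5c_2^2\delta^2-2136\,c_1^4c_2^3\delta^2+96\,c_1^3c_2^4\delta^2+8\,c_1^2c_2^5\delta^2-256\,c_1^6+544\,c_1^5c_2\\ &-353\,c_1^4c_2^2+100\,c_1^3c_2^3-38\,c_1^2c_2^4+4\,c_1c_2^5-c_2^6 . \end{align*} Furthermore, the only possible bifurcation for the equilibrium of Model GL (as the parameters $(c_1,c_2,\delta)$ vary in the positive orthant) is the period-doubling bifurcation, which may occur when $R_{GL}^1=0$; that is, at any parameter point where the equilibrium loses its stability one has $CP(-1)=0$, while $CP(1)\neq0$ and $\det J\neq1$, and $R_{GL}^1=0$.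
   Context: Parameters: $c_1,c_2,\delta>0$. For $x_1,x_2>0$, $$G_1(x_1,x_2)=\frac{x_1x_2}{(x_1+x_2)^2}-2c_1x_1^2 .$$ An equilibrium is a fixed point of the map. Let $J$ be the $2\times2$ Jacobian matrix of the map $(x_1(t),x_2(t))\mapsto(x_1(t+1),x_2(t+1))$ at the positive equilibrium, and $CP(\lambda)=\lambda^2-\operatorname{tr}(J)\lambda+\det(J)$ its characteristic polynomial. The equilibrium is called locally stable if all eigenvalues of $J$ lie in the open unit disk, equivalently (Jury criterion) $CP(1)>0$, $CP(-1)>0$ and $1-\det(J)>0$. Bifurcation terminology: the equilibrium "loses its stability" at a parameter point of the positive orthant $\{c_1,c_2,\delta>0\}$ lying on the boundary of the set of parameters where it is locally stable (and not in that set); a fold, period-doubling, or Neimark-Sacker bifurcation is possible there if $CP(1)=0$, $CP(-1)=0$, or $1-\det(J)=0$, respectively. *)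

theory Defs
  imports "HOL-Analysis.Analysis"
begin

definition G1 :: "real \<Rightarrow> real \<Rightarrow> real \<Rightarrow> real" where
  "G1 c1 x1 x2 = x1 * x2 / (x1 + x2)^2 - 2 * c1 * x1^2"

text \<open>Parameter triples are always ordered as \<open>(c1, c2, \<delta>)\<close>.\<close>

type_synonym params = "real \<times> real \<times> real"

definition positive_params :: "params set" where
  "positive_params = {(c1, c2, \<delta>). c1 > 0 \<and> c2 > 0 \<and> \<delta> > 0}"

fun GL_map :: "params \<Rightarrow> real^2 \<Rightarrow> real^2" where
  "GL_map (c1, c2, \<delta>) x =
     vector [x$1 + \<delta> * G1 c1 (x$1) (x$2),
             (2 * x$2 + x$1) / (2 * (1 + c2 * (x$1 + x$2)^2))]"

definition positive_equilibrium :: "(real^2 \<Rightarrow> real^2) \<Rightarrow> real^2 \<Rightarrow> bool" where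
  "positive_equilibrium F x \<longleftrightarrow> F x = x \<and> x$1 > 0 \<and> x$2 > 0"

definition GL_equilibrium :: "params \<Rightarrow> real^2" where
  "GL_equilibrium p = (THE x. positive_equilibrium (GL_map p) x)"

definition GL_J :: "params \<Rightarrow> real^2^2" where
  "GL_J p = jacobian (GL_map p) (at (GL_equilibrium p))"

definition CP :: "real^2^2 \<Rightarrow> real \<Rightarrow> real" where
  "CP A l = l^2 - trace A * l + det A"

text \<open>Eigenvalues of a real matrix are taken over the complex numbers.\<close>

definition complex_eigenvalue :: "real^'n^'n \<Rightarrow> complex \<Rightarrow> bool" where
  "complex_eigenvalue A l \<longleftrightarrow>
     (\<exists>v :: complex^'n. v \<noteq> 0 \<and> (\<chi> i j. complex_of_real (A$i$j)) *v v = l *s v)"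

definition GL_locally_stable :: "params \<Rightarrow> bool" where
  "GL_locally_stable p \<longleftrightarrow> (\<forall>l. complex_eigenvalue (GL_J p) l \<longrightarrow> cmod l < 1)"

definition GL_stable_region :: "params set" where
  "GL_stable_region = {p \<in> positive_params. GL_locally_stable p}"

text \<open>The positive orthant is open, so for its points the boundary in the whole parameter
  space agrees with the boundary relative to the orthant.\<close>

definition GL_loses_stability :: "params \<Rightarrow> bool" where
  "GL_loses_stability p \<longleftrightarrow>
     p \<in> positive_params \<and> p \<in> frontier GL_stable_region \<and> p \<notin> GL_stable_region"

fun R_GL1 :: "params \<Rightarrow> real" where
  "R_GL1 (c1, c2, \<delta>) =
     64 * c1^7 * c2 * \<delta>^4 - 672 * c1^6 * c2^2 * \<delta>^4 + 1796 * c1^5 * c2^3 * \<delta>^4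
     - 168 * c1^4 * c2^4 * \<delta>^4 + 4 * c1^3 * c2^5 * \<delta>^4
     + 384 * c1^6 * c2 * \<delta>^2 - 400 * c1^5 * c2^2 * \<delta>^2 - 2136 * c1^4 * c2^3 * \<delta>^2
     + 96 * c1^3 * c2^4 * \<delta>^2 + 8 * c1^2 * c2^5 * \<delta>^2
     - 256 * c1^6 + 544 * c1^5 * c2 - 353 * c1^4 * c2^2 + 100 * c1^3 * c2^3
     - 38 * c1^2 * c2^4 + 4 * c1 * c2^5 - c2^6"

end

theory Submission
  imports Defs
begin

text \<open>At the positive equilibrium put \<open>k = x\<^sub>2 / x\<^sub>1 = sqrt (c\<^sub>1 / c\<^sub>2)\<close>, \<open>S = x\<^sub>1 + x\<^sub>2\<close> and
  \<open>d = \<delta> / (S (1 + k)\<^sup>2)\<close>. The Jacobian matrix becomes rational in \<open>k\<close> and \<open>d\<close>, and with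
  \<open>P(k) = 2k\<^sup>2 + 5k + 1\<close> and \<open>Q(k) = 4k\<^sup>2 + 3k + 1\<close> one finds that \<open>CP(1) > 0\<close> always, that
  \<open>CP(-1)\<close> is a positive multiple of \<open>Q(k) - d k (k + 1) P(k)\<close>, and that \<open>CP(-1) \<ge> 0\<close> forces
  \<open>det J < 1\<close>. Hence stability is governed by \<open>CP(-1)\<close> alone. Squaring to eliminate \<open>S\<close> gives
  \<open>A(k) = 2 k\<^sup>3 c\<^sub>2 \<delta>\<^sup>2 P(k)\<^sup>2 - Q(k)\<^sup>2 (k + 1)\<^sup>2\<close>, which has the sign of \<open>-CP(-1)\<close>, and \<open>R\<^sub>G\<^sub>L\<close> is the
  norm \<open>-c\<^sub>2\<^sup>6 A(k) A(-k)\<close> that eliminates the square root in \<open>k\<close>; here \<open>-A(-k) \<ge> 0\<close>.\<close>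

section \<open>Eigenvalues of real 2 x 2 matrices and the Jury criterion\<close>

text \<open>Eigenvectors for \<open>l\<close> are the nonzero kernel vectors of \<open>B\<close>,
  and these exist exactly if \<open>det B\<close> vanishes.\<close>

lemma complex_eigenvalue_iff:
  "complex_eigenvalue (A :: real^2^2) l \<longleftrightarrow>
     l^2 - complex_of_real (trace A) * l + complex_of_real (det A) = 0"
proof -
  define B :: "complex^2^2" where "B = (\<chi> i j. complex_of_real (A$i$j)) - mat l"
  have *: "B *v v = 0 \<longleftrightarrow> (\<chi> i j. complex_of_real (A$i$j)) *v v = l *s v" for v
    by (auto simp: B_def matrix_vector_mult_def mat_def vec_eq_iff sum_2 forall_2 algebra_simps)
  have "complex_eigenvalue A l \<longleftrightarrow> det B = 0"
    unfolding complex_eigenvalue_def *[symmetric]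
    using invertible_det_nz[of B] matrix_left_invertible_ker[of B]
    by (auto simp: invertible_left_inverse)
  also have "det B = l^2 - complex_of_real (trace A) * l + complex_of_real (det A)"
    by (simp add: B_def det_2 trace_def sum_2 mat_def power2_eq_square algebra_simps)
  finally show ?thesis .
qed

text \<open>This is the sufficient half of the Jury criterion: \<open>pos\<close> gives the values
  of the quadratic at 1 and -1, and \<open>D\<close> is the product of its roots.\<close>

lemma quadratic_root_in_unit_disk:
  fixes T D :: real and z :: complex
  assumes root: "z^2 - complex_of_real T * z + complex_of_real D = 0"
    and pos: "1 - T + D > 0" "1 + T + D > 0" and "D < 1"
  shows "cmod z < 1"
proof -
  have re: "(Re z)^2 - (Im z)^2 - T * Re z + D = 0"
    and im: "2 * Re z * Im z - T * Im z = 0"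
    using arg_cong[OF root, of Re] arg_cong[OF root, of Im] by (simp_all add: power2_eq_square)
  have "(cmod z)^2 < 1"
  proof (cases "Im z = 0")
    case False
    \<comment> \<open>A non-real root comes with its conjugate, so \<open>T\<close> is their sum and
      \<open>D\<close> their product.\<close>
    then have "T = 2 * Re z" using im by (simp add: algebra_simps)
    then have "D = (cmod z)^2" using re unfolding cmod_power2 by (simp add: power2_eq_square)
    then show ?thesis using \<open>D < 1\<close> by simp
  next
    case True
    define r where "r = Re z"
    \<comment> \<open>\<open>t\<close> is the other root. The values at 1 and -1 factor, and if
      \<open>r\<close> were beyond 1 or -1, then \<open>t\<close> would be too, on the same side, so
      that \<open>D\<close> would be at least 1.\<close>
    define t where "t = T - r"
    have D: "D = r * t" using re True by (simp add: t_def r_def power2_eq_square algebra_simps)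
    have T: "T = r + t" by (simp add: t_def)
    have p: "(1 - r) * (1 - t) > 0" "(1 + r) * (1 + t) > 0"
      using pos by (simp_all add: T D algebra_simps)
    have "\<not> r \<ge> 1"
    proof
      assume "r \<ge> 1"
      then have "t > 1" using p(1) by (auto simp: zero_less_mult_iff)
      then have "1 \<le> r * t" using \<open>r \<ge> 1\<close> mult_mono[of 1 r 1 t] by simp
      then show False using \<open>D < 1\<close> D by simp
    qed
    moreover have "\<not> r \<le> -1"
    proof
      assume "r \<le> -1"
      then have "t < -1" using p(2) by (auto simp: zero_less_mult_iff)
      then have "1 \<le> r * t" using \<open>r \<le> -1\<close> mult_mono[of 1 "-r" 1 "-t"] by simp
      then show False using \<open>D < 1\<close> D by simp
    qed
    ultimately have "\<bar>r\<bar> < 1" by linarith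
    then show ?thesis using True by (simp add: cmod_power2 r_def abs_square_less_1)
  qed
  then show ?thesis by (simp add: power_less_one_iff abs_square_less_1)
qed

text \<open>A negative value at -1 puts -1 strictly between the two real roots; the smaller one is
  the witness.\<close>

lemma quadratic_root_below_minus_one:
  fixes T D :: real
  assumes "1 + T + D < 0"
  obtains r where "r < -1" "r^2 - T * r + D = 0"
proof -
  define q where "q = sqrt (T^2 - 4 * D)"
  \<comment> \<open>The left side minus the right side is four times the value at -1.\<close>
  have less: "\<bar>T + 2\<bar>^2 < T^2 - 4 * D"
    using assms by (simp add: power2_eq_square algebra_simps)
  then have "\<bar>T + 2\<bar> < q"
    unfolding q_def by (rule real_less_rsqrt)
  moreover have "0 \<le> T^2 - 4 * D"
    using less zero_le_power2[of "\<bar>T + 2\<bar>"] by linarith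
  then have "q^2 = T^2 - 4 * D"
    by (simp add: q_def)
  ultimately show ?thesis
    by (intro that[of "(T - q) / 2"]) (auto simp: power2_eq_square field_simps)
qed

section \<open>The equilibrium in terms of ratio and total\<close>

definition GL_ratio :: "params \<Rightarrow> real" where
  "GL_ratio = (\<lambda>(c1, c2, \<delta>). sqrt (c1 / c2))"

text \<open>The formula is the value of \<open>x$1 + x$2\<close> at the positive
  equilibrium.\<close>

definition GL_total :: "params \<Rightarrow> real" where
  "GL_total = (\<lambda>(c1, c2, \<delta>). sqrt (1 / (2 * sqrt (c1 * c2))))"

text \<open>Inverting the change of parameters makes \<open>c1\<close> and \<open>c2\<close>
  rational in \<open>k\<close> and \<open>s\<close>, so later identities follow by clearing
  denominators.\<close>

lemma GL_ratio_total:
  fixes c1 c2 \<delta> :: real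
  assumes "c1 > 0" "c2 > 0"
  defines "k \<equiv> GL_ratio (c1, c2, \<delta>)" and "s \<equiv> GL_total (c1, c2, \<delta>)"
  shows "k > 0" "s > 0" "c1 = k / (2 * s^2)" "c2 = 1 / (2 * k * s^2)"
proof -
  show "k > 0" "s > 0" using assms by (simp_all add: k_def s_def GL_ratio_def GL_total_def)
  have s: "s^2 = 1 / (2 * sqrt (c1 * c2))"
    using assms by (simp add: s_def GL_total_def)
  show "c1 = k / (2 * s^2)" "c2 = 1 / (2 * k * s^2)"
    unfolding s using assms
    by (simp_all add: k_def GL_ratio_def real_sqrt_mult real_sqrt_divide)
qed

lemma positive_equilibrium_iff:
  fixes k s \<delta> :: real
  assumes "k > 0" "s > 0" "\<delta> > 0"
  shows "positive_equilibrium (GL_map (k / (2 * s^2), 1 / (2 * k * s^2), \<delta>)) x \<longleftrightarrow>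
    x = vector [s / (1 + k), k * s / (1 + k)]"
proof -
  define a b where "a = x$1" and "b = x$2"
  have "positive_equilibrium (GL_map (k / (2 * s^2), 1 / (2 * k * s^2), \<delta>)) x \<longleftrightarrow>
      G1 (k / (2 * s^2)) a b = 0 \<and> (2 * b + a) / (2 * (1 + 1 / (2 * k * s^2) * (a + b)^2)) = b
      \<and> a > 0 \<and> b > 0"
    using assms by (auto simp: positive_equilibrium_def vec_eq_iff forall_2 a_def b_def)
  also have "\<dots> \<longleftrightarrow> a = s / (1 + k) \<and> b = k * s / (1 + k)"
  proof (intro iffI conjI; (elim conjE)?)
    assume g: "G1 (k / (2 * s^2)) a b = 0"
      and h: "(2 * b + a) / (2 * (1 + 1 / (2 * k * s^2) * (a + b)^2)) = b"
      and ab: "a > 0" "b > 0"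
    have "1 + 1 / (2 * k * s^2) * (a + b)^2 > 0"
      using assms ab by (intro add_pos_nonneg) auto
    then have "2 * (1 + 1 / (2 * k * s^2) * (a + b)^2) \<noteq> 0"
      by (metis less_irrefl mult_eq_0_iff zero_neq_numeral)
    with h have "2 * b + a = b * (2 * (1 + 1 / (2 * k * s^2) * (a + b)^2))"
      by (simp only: divide_eq_eq if_False simp_thms)
    then have h': "b * (a + b)^2 = a * (k * s^2)"
      using assms by (simp add: field_simps)
    have "a * b * s^2 = k * a^2 * (a + b)^2"
      using g assms ab by (simp add: G1_def divide_simps)
    then have g': "b * s^2 = k * a * (a + b)^2"
      using ab by (simp add: power2_eq_square)
    \<comment> \<open>Multiplying by \<open>b\<close> allows \<open>h'\<close> to eliminate
      \<open>(a + b)^2\<close>, which leaves the ratio of \<open>b\<close> to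
      \<open>a\<close>.\<close>
    have "b^2 * s^2 = k * a * (b * (a + b)^2)"
      using arg_cong[OF g', of "\<lambda>t. t * b"] by (simp add: power2_eq_square algebra_simps)
    then have "b^2 * s^2 = (k * a)^2 * s^2"
      unfolding h' by (simp add: power2_eq_square algebra_simps)
    then have b: "b = k * a"
      using assms ab by (simp add: power2_eq_iff_nonneg)
    have "(a + b)^2 = s^2"
      using g' assms ab by (simp add: b)
    then have "a * (1 + k) = s"
      using assms ab by (simp add: power2_eq_iff_nonneg b algebra_simps)
    then show "a = s / (1 + k)" "b = k * s / (1 + k)"
      using assms b by (auto simp: field_simps)
  next
    assume a: "a = s / (1 + k)" and b: "b = k * s / (1 + k)"
    have ab: "a + b = s"
      using assms by (simp add: a b divide_eq_eq algebra_simps flip: add_divide_distrib)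
    show "a > 0" "b > 0" using assms by (simp_all add: a b)
    show "G1 (k / (2 * s^2)) a b = 0"
      unfolding G1_def ab using assms by (simp add: a b power2_eq_square divide_simps)
    show "(2 * b + a) / (2 * (1 + 1 / (2 * k * s^2) * (a + b)^2)) = b"
      unfolding ab using assms by (simp add: a b divide_simps) (simp add: algebra_simps)
  qed
  also have "\<dots> \<longleftrightarrow> x = vector [s / (1 + k), k * s / (1 + k)]"
    by (simp add: vec_eq_iff forall_2 a_def b_def)
  finally show ?thesis .
qed

section \<open>The Jacobian matrix\<close>

lemma has_derivative_vec_nth:
  "((\<lambda>y :: real^'n. y$i) has_derivative (\<lambda>h. h$i)) F"
  by (rule bounded_linear.has_derivative[OF bounded_linear_vec_nth has_derivative_ident])

lemma has_derivative_GL_map_1: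
  fixes x :: "real^2"
  assumes "x$1 + x$2 \<noteq> 0"
  shows "((\<lambda>y. y$1 + \<delta> * G1 c1 (y$1) (y$2)) has_derivative
    (\<lambda>h. (1 + \<delta> * (x$2 * (x$2 - x$1) / (x$1 + x$2)^3 - 4 * c1 * x$1)) * h$1
       + \<delta> * (x$1 * (x$1 - x$2) / (x$1 + x$2)^3) * h$2)) (at x)"
proof -
  \<comment> \<open>Eliminating \<open>x$2\<close> in favour of \<open>S\<close> turns the
    denominators into powers of a single nonzero variable.\<close>
  define S where "S = x$1 + x$2"
  have x2: "x$2 = S - x$1" and "S \<noteq> 0" using assms by (simp_all add: S_def)
  show ?thesis
    unfolding G1_def
    apply (rule derivative_eq_intros has_derivative_vec_nth refl ext
        | (use assms in \<open>simp; fail\<close>))+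
    unfolding x2 using \<open>S \<noteq> 0\<close>
    apply (simp add: divide_simps)
    apply (simp add: algebra_simps power_numeral_reduce)
    done
qed

lemma has_derivative_GL_map_2:
  fixes x :: "real^2"
  assumes "1 + c2 * (x$1 + x$2)^2 \<noteq> 0"
  shows "((\<lambda>y. (2 * y$2 + y$1) / (2 * (1 + c2 * (y$1 + y$2)^2))) has_derivative
    (\<lambda>h. (1 / (2 * (1 + c2 * (x$1 + x$2)^2))
         - (2 * x$2 + x$1) * c2 * (x$1 + x$2) / (1 + c2 * (x$1 + x$2)^2)^2) * h$1
       + (1 / (1 + c2 * (x$1 + x$2)^2)
         - (2 * x$2 + x$1) * c2 * (x$1 + x$2) / (1 + c2 * (x$1 + x$2)^2)^2) * h$2)) (at x)"
proof -
  define D where "D = 1 + c2 * (x$1 + x$2)^2"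
  have "D \<noteq> 0" using assms by (simp add: D_def)
  show ?thesis
    apply (rule derivative_eq_intros has_derivative_vec_nth refl ext
        | (use assms in \<open>simp; fail\<close>))+
    unfolding D_def[symmetric] using \<open>D \<noteq> 0\<close>
    apply (simp add: divide_simps)
    apply (simp add: algebra_simps power_numeral_reduce)
    done
qed

text \<open>The componentwise derivatives assemble into multiplication by a matrix, which uniqueness
  of the Frechet derivative identifies with \<open>jacobian\<close>.\<close>

lemma jacobian_GL_map:
  fixes x :: "real^2"
  assumes "x$1 + x$2 \<noteq> 0" "1 + c2 * (x$1 + x$2)^2 \<noteq> 0"
  shows "jacobian (GL_map (c1, c2, \<delta>)) (at x) =
    (let S = x$1 + x$2; D = 1 + c2 * S^2 in
     vector [vector [1 + \<delta> * (x$2 * (x$2 - x$1) / S^3 - 4 * c1 * x$1),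
                     \<delta> * (x$1 * (x$1 - x$2) / S^3)],
             vector [1 / (2 * D) - (2 * x$2 + x$1) * c2 * S / D^2,
                     1 / D - (2 * x$2 + x$1) * c2 * S / D^2]])"
    (is "_ = ?J")
proof -
  have "(GL_map (c1, c2, \<delta>) has_derivative (\<lambda>h. ?J *v h)) (at x)"
    unfolding has_derivative_componentwise_within[of "GL_map (c1, c2, \<delta>)"]
    using has_derivative_GL_map_1[OF assms(1)] has_derivative_GL_map_2[OF assms(2)]
    by (auto simp: Basis_vec_def inner_axis exhaust_2 forall_2 Let_def matrix_vector_mult_def sum_2)
  then show ?thesis
    unfolding jacobian_def
    by (metis frechet_derivative_at matrix_of_matrix_vector_mul)
qed

text \<open>This rescaling of \<open>\<delta>\<close> absorbs \<open>s\<close>, so the Jacobian at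
  the equilibrium involves two quantities only.\<close>

definition GL_step :: "params \<Rightarrow> real" where
  "GL_step = (\<lambda>(c1, c2, \<delta>). \<delta> / (GL_total (c1, c2, \<delta>) * (1 + GL_ratio (c1, c2, \<delta>))^2))"

lemma GL_J_eq:
  fixes c1 c2 \<delta> :: real
  assumes "c1 > 0" "c2 > 0" "\<delta> > 0"
  defines "k \<equiv> GL_ratio (c1, c2, \<delta>)" and "d \<equiv> GL_step (c1, c2, \<delta>)"
  shows "GL_J (c1, c2, \<delta>) =
    vector [vector [1 - d * k * (k + 3), d * (1 - k)],
            vector [k * (k - 1) / ((2 * k + 1) * (k + 1)), 2 * k^2 / ((2 * k + 1) * (k + 1))]]"
proof -
  define s where "s = GL_total (c1, c2, \<delta>)"
  have k: "k > 0" and s: "s > 0" and c1: "c1 = k / (2 * s^2)" and c2: "c2 = 1 / (2 * k * s^2)"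
    using GL_ratio_total[OF assms(1,2)] by (simp_all add: k_def s_def)
  have d: "d = \<delta> / (s * (1 + k)^2)"
    by (simp add: d_def GL_step_def k_def s_def)
  define x :: "real^2" where "x = vector [s / (1 + k), k * s / (1 + k)]"
  have eq: "GL_equilibrium (c1, c2, \<delta>) = x"
    using positive_equilibrium_iff[OF k s assms(3)]
    by (simp add: GL_equilibrium_def c1 c2 x_def)
  have total: "x$1 + x$2 = s"
    using k by (simp add: x_def divide_eq_eq algebra_simps flip: add_divide_distrib)
  \<comment> \<open>Since \<open>c2 * s^2 = 1 / (2 * k)\<close>, the total drops out of the second
    row.\<close>
  have D: "1 + c2 * s^2 = (2 * k + 1) / (2 * k)"
    using k s by (simp add: c2 field_simps)
  have "GL_J (c1, c2, \<delta>) =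
     vector [vector [1 + \<delta> * (x$2 * (x$2 - x$1) / s^3 - 4 * c1 * x$1),
                     \<delta> * (x$1 * (x$1 - x$2) / s^3)],
             vector [1 / (2 * (1 + c2 * s^2)) - (2 * x$2 + x$1) * c2 * s / (1 + c2 * s^2)^2,
                     1 / (1 + c2 * s^2) - (2 * x$2 + x$1) * c2 * s / (1 + c2 * s^2)^2]]"
    unfolding GL_J_def eq
  proof (subst jacobian_GL_map)
    show "x$1 + x$2 \<noteq> 0" "1 + c2 * (x$1 + x$2)^2 \<noteq> 0"
      unfolding total D using k s by simp_all
  qed (simp only: total Let_def)
  moreover have "1 + \<delta> * (x$2 * (x$2 - x$1) / s^3 - 4 * c1 * x$1) = 1 - d * k * (k + 3)"
    using k s unfolding x_def c1 d
    by (simp add: divide_simps) (simp add: power2_eq_square power3_eq_cube algebra_simps)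
  moreover have "\<delta> * (x$1 * (x$1 - x$2) / s^3) = d * (1 - k)"
    using k s unfolding x_def d
    by (simp add: divide_simps) (simp add: power2_eq_square power3_eq_cube algebra_simps)
  \<comment> \<open>This subtrahend is common to both entries of the second row.\<close>
  moreover have "(2 * x$2 + x$1) * c2 * s / (1 + c2 * s^2)^2 = 2 * k / ((2 * k + 1) * (k + 1))"
    unfolding D using k s unfolding x_def c2
    by (simp add: divide_simps) (simp add: power2_eq_square power3_eq_cube algebra_simps)
  moreover have "1 / (2 * (1 + c2 * s^2)) - 2 * k / ((2 * k + 1) * (k + 1)) =
      k * (k - 1) / ((2 * k + 1) * (k + 1))"
    unfolding D using k by (simp add: divide_simps) (simp add: power2_eq_square algebra_simps)
  moreover have "1 / (1 + c2 * s^2) - 2 * k / ((2 * k + 1) * (k + 1)) =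
      2 * k^2 / ((2 * k + 1) * (k + 1))"
    unfolding D using k by (simp add: divide_simps) (simp add: power2_eq_square algebra_simps)
  ultimately show ?thesis by simp
qed

section \<open>The three Jury quantities\<close>

text \<open>All denominators are positive, so the signs are those of the numerators.\<close>

lemma
  fixes c1 c2 \<delta> :: real
  assumes "c1 > 0" "c2 > 0" "\<delta> > 0"
  defines "k \<equiv> GL_ratio (c1, c2, \<delta>)" and "d \<equiv> GL_step (c1, c2, \<delta>)"
  shows CP_GL_J_1: "CP (GL_J (c1, c2, \<delta>)) 1 = 4 * d * k * (k + 1) / (2 * k + 1)"
    and CP_GL_J_minus_1: "CP (GL_J (c1, c2, \<delta>)) (-1) =
      2 * (4*k^2 + 3*k + 1 - d * k * (k + 1) * (2*k^2 + 5*k + 1)) / ((2 * k + 1) * (k + 1))"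
    and det_GL_J: "1 - det (GL_J (c1, c2, \<delta>)) =
      (3*k + 1 - d * k * (k + 1) * (1 - 3*k - 2*k^2)) / ((2 * k + 1) * (k + 1))"
proof -
  have k: "k > 0" using GL_ratio_total[OF assms(1,2)] by (simp add: k_def)
  note J = GL_J_eq[OF assms(1-3), folded k_def d_def]
  show "CP (GL_J (c1, c2, \<delta>)) 1 = 4 * d * k * (k + 1) / (2 * k + 1)"
    unfolding CP_def J det_2 trace_def sum_2 using k
    by (simp add: divide_simps) (simp add: algebra_simps power_numeral_reduce)
  show "CP (GL_J (c1, c2, \<delta>)) (-1) =
      2 * (4*k^2 + 3*k + 1 - d * k * (k + 1) * (2*k^2 + 5*k + 1)) / ((2 * k + 1) * (k + 1))"
    unfolding CP_def J det_2 trace_def sum_2 using k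
    by (simp add: divide_simps) (simp add: algebra_simps power_numeral_reduce)
  show "1 - det (GL_J (c1, c2, \<delta>)) =
      (3*k + 1 - d * k * (k + 1) * (1 - 3*k - 2*k^2)) / ((2 * k + 1) * (k + 1))"
    unfolding det_2 J using k
    by (simp add: divide_simps) (simp add: algebra_simps power_numeral_reduce)
qed

lemma GL_step_pos:
  assumes "c1 > 0" "c2 > 0" "\<delta> > 0"
  shows "GL_step (c1, c2, \<delta>) > 0"
  using GL_ratio_total(1,2)[OF assms(1,2)] assms(3)
  by (auto simp: GL_step_def intro!: divide_pos_pos mult_pos_pos zero_less_power add_pos_pos)

lemma CP_GL_J_1_pos:
  assumes "c1 > 0" "c2 > 0" "\<delta> > 0"
  shows "CP (GL_J (c1, c2, \<delta>)) 1 > 0"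
  using GL_ratio_total(1)[OF assms(1,2), of \<delta>] GL_step_pos[OF assms]
  by (simp add: CP_GL_J_1[OF assms] add_pos_pos)

text \<open>The hypothesis bounds \<open>e\<close> by \<open>Q(k) / P(k)\<close>. If
  \<open>1 - 3*k - 2*k^2\<close> is positive, inserting this bound reduces the claim to
  \<open>Q(k) * (1 - 3*k - 2*k^2) < 1 < (3*k + 1) * P(k)\<close>; otherwise the claim holds by
  signs.\<close>

lemma det_GL_J_less_1:
  assumes "c1 > 0" "c2 > 0" "\<delta> > 0" and "CP (GL_J (c1, c2, \<delta>)) (-1) \<ge> 0"
  shows "det (GL_J (c1, c2, \<delta>)) < 1"
proof -
  define k where "k = GL_ratio (c1, c2, \<delta>)"
  define e where "e = GL_step (c1, c2, \<delta>) * k * (k + 1)"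
  have k: "k > 0" and e: "e > 0"
    using GL_ratio_total(1)[OF assms(1,2)] GL_step_pos[OF assms(1-3)]
    by (auto simp: k_def e_def intro!: mult_pos_pos add_pos_pos)
  have M: "(2 * k + 1) * (k + 1) > 0" using k by simp
  have le: "e * (2*k^2 + 5*k + 1) \<le> 4*k^2 + 3*k + 1"
    using assms(4) M unfolding CP_GL_J_minus_1[OF assms(1-3)] k_def[symmetric] e_def[symmetric]
    by (simp add: zero_le_divide_iff)
  have "e * (1 - 3*k - 2*k^2) < 3*k + 1"
  proof (cases "1 - 3*k - 2*k^2 > 0")
    case True
    have "e * (2*k^2 + 5*k + 1) * (1 - 3*k - 2*k^2) \<le> (4*k^2 + 3*k + 1) * (1 - 3*k - 2*k^2)"
      using le True by (intro mult_right_mono) auto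
    also have "\<dots> = 1 - 7 * k^2 - 18 * k^3 - 8 * k^4"
      by (simp add: algebra_simps power_numeral_reduce)
    also have "\<dots> < 1"
      using k by (smt (verit) zero_less_power)
    also have "1 < (3*k + 1) * (2*k^2 + 5*k + 1)"
      using k by (smt (verit) mult_le_cancel_left1 zero_le_power2)
    finally have "(e * (1 - 3*k - 2*k^2)) * (2*k^2 + 5*k + 1) < (3*k + 1) * (2*k^2 + 5*k + 1)"
      by (simp add: mult_ac)
    then show ?thesis
      using k by (simp add: mult_less_cancel_right_pos add_pos_pos)
  next
    case False
    then have "e * (1 - 3*k - 2*k^2) \<le> 0" using e by (simp add: mult_nonneg_nonpos)
    then show ?thesis using k by linarith
  qed
  then have "1 - det (GL_J (c1, c2, \<delta>)) > 0"
    using M unfolding det_GL_J[OF assms(1-3)] k_def[symmetric] e_def[symmetric] by simp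
  then show ?thesis by simp
qed

lemma GL_locally_stable_if_CP_pos:
  assumes "c1 > 0" "c2 > 0" "\<delta> > 0" and "CP (GL_J (c1, c2, \<delta>)) (-1) > 0"
  shows "GL_locally_stable (c1, c2, \<delta>)"
  unfolding GL_locally_stable_def complex_eigenvalue_iff
  using quadratic_root_in_unit_disk CP_GL_J_1_pos[OF assms(1-3)] det_GL_J_less_1[OF assms(1-3)] assms(4)
  by (simp add: CP_def)

text \<open>A negative value of \<open>CP\<close> at -1 yields a real eigenvalue below -1.\<close>

lemma CP_nonneg_if_GL_locally_stable:
  assumes "GL_locally_stable p"
  shows "CP (GL_J p) (-1) \<ge> 0"
proof (rule ccontr)
  assume "\<not> ?thesis"
  then have "1 + trace (GL_J p) + det (GL_J p) < 0" by (simp add: CP_def)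
  then obtain r where r: "r < -1" "r^2 - trace (GL_J p) * r + det (GL_J p) = 0"
    by (rule quadratic_root_below_minus_one)
  then have "complex_eigenvalue (GL_J p) (complex_of_real r)"
    unfolding complex_eigenvalue_iff
    by (metis of_real_0 of_real_add of_real_diff of_real_mult of_real_power)
  then have "cmod (complex_of_real r) < 1"
    using assms unfolding GL_locally_stable_def by blast
  then show False using r(1) by simp
qed

section \<open>The sign of \<open>R_GL1\<close>\<close>

text \<open>With \<open>c1 = k^2 * c\<close> the polynomial is even in \<open>k\<close>; the last
  factor is the middle one under \<open>k\<close> to \<open>-k\<close>, with its sign
  reversed.\<close>

lemma R_GL1_factorization:
  "R_GL1 (k^2 * c, c, \<delta>) = c^6
     * (2 * k^3 * (c * \<delta>^2) * (2*k^2 + 5*k + 1)^2 - (4*k^2 + 3*k + 1)^2 * (k + 1)^2)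
     * (2 * k^3 * (c * \<delta>^2) * (2*k^2 - 5*k + 1)^2 + (4*k^2 - 3*k + 1)^2 * (k - 1)^2)"
  unfolding R_GL1.simps by algebra

text \<open>The form with \<open>A \<ge> 0\<close> serves two conclusions: negative
  \<open>R_GL1\<close> forces a positive \<open>CP\<close> at -1, and a zero of \<open>CP\<close> at
  -1 forces \<open>R_GL1\<close> to vanish.\<close>

lemma R_GL1_sign:
  assumes "c1 > 0" "c2 > 0" "\<delta> > 0"
  obtains A where "A \<ge> 0" "R_GL1 (c1, c2, \<delta>) = - A * CP (GL_J (c1, c2, \<delta>)) (-1)"
proof -
  define k s d where "k = GL_ratio (c1, c2, \<delta>)" and "s = GL_total (c1, c2, \<delta>)"
    and "d = GL_step (c1, c2, \<delta>)"
  have k: "k > 0" and s: "s > 0" and c1: "c1 = k / (2 * s^2)" and c2: "c2 = 1 / (2 * k * s^2)"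
    using GL_ratio_total[OF assms(1,2)] by (simp_all add: k_def s_def)
  have d: "d = \<delta> / (s * (1 + k)^2)" and "d > 0"
    using GL_step_pos[OF assms] by (simp_all add: d_def GL_step_def k_def s_def)
  define e where "e = d * k * (k + 1)"
  define P Q where "P = 2*k^2 + 5*k + 1" and "Q = 4*k^2 + 3*k + 1"
  define B where "B = 2 * k^3 * (c2 * \<delta>^2) * (2*k^2 - 5*k + 1)^2 + (4*k^2 - 3*k + 1)^2 * (k - 1)^2"
  have pos: "e > 0" "P > 0" "Q > 0"
    using k \<open>d > 0\<close> by (simp_all add: e_def P_def Q_def add_pos_pos)
  have "c1 = k^2 * c2" using k by (simp add: c1 c2 power2_eq_square)
  \<comment> \<open>Substituting \<open>d\<close> cancels \<open>s\<close> and leaves a perfect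
    square, so the middle factor becomes a difference of squares with \<open>Q - e * P\<close> as a
    factor.\<close>
  moreover have "2 * k^3 * (c2 * \<delta>^2) = e^2 * (k + 1)^2"
  proof -
    have "\<delta> = d * s * (k + 1)^2" using k s by (simp add: d add.commute)
    then show ?thesis
      using k s by (simp add: c2 e_def divide_simps) (simp add: algebra_simps power_numeral_reduce)
  qed
  ultimately have "R_GL1 (c1, c2, \<delta>) = c2^6 * (e^2 * (k + 1)^2 * P^2 - Q^2 * (k + 1)^2) * B"
    using R_GL1_factorization[of k c2 \<delta>] by (simp add: P_def Q_def B_def)
  also have "\<dots> = - (c2^6 * (k + 1)^2 * (Q + e * P)) * B * (Q - e * P)"
    by (simp add: algebra_simps power2_eq_square)
  also have "Q - e * P = CP (GL_J (c1, c2, \<delta>)) (-1) * ((2 * k + 1) * (k + 1) / 2)"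
    using k unfolding CP_GL_J_minus_1[OF assms] k_def[symmetric] d_def[symmetric]
    by (simp add: e_def P_def Q_def)
  finally have "R_GL1 (c1, c2, \<delta>) =
      - (c2^6 * (k + 1)^2 * (Q + e * P) * B * ((2 * k + 1) * (k + 1) / 2))
        * CP (GL_J (c1, c2, \<delta>)) (-1)"
    by (simp only: mult_ac mult_minus_left mult_minus_right)
  moreover have "c2^6 * (k + 1)^2 * (Q + e * P) * B * ((2 * k + 1) * (k + 1) / 2) \<ge> 0"
    using k pos assms by (simp add: B_def)
  ultimately show ?thesis using that by blast
qed

section \<open>Continuity and the boundary of the stable region\<close>

lemma open_positive_params: "open positive_params"
proof -
  have "positive_params = {0<..} \<times> {0<..} \<times> {0<..}"
    by (auto simp: positive_params_def)
  then show ?thesis by (metis open_Times open_greaterThan)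
qed

text \<open>\<open>GL_J\<close> is defined by a description and a derivative, so continuity is
  transferred from the explicit formula on the orthant.\<close>

lemma continuous_on_CP_GL_J: "continuous_on positive_params (\<lambda>p. CP (GL_J p) (-1))"
proof -
  have ratio: "continuous_on positive_params GL_ratio"
    unfolding GL_ratio_def positive_params_def case_prod_unfold
    by (intro continuous_intros) auto
  have total: "continuous_on positive_params GL_total"
    unfolding GL_total_def positive_params_def case_prod_unfold
    by (intro continuous_intros) auto
  have pos: "GL_ratio p > 0" "GL_total p > 0" if "p \<in> positive_params" for p
    using that GL_ratio_total(1,2) by (auto simp: positive_params_def)
  have step: "continuous_on positive_params GL_step"
  proof -
    have eq: "GL_step = (\<lambda>p. snd (snd p) / (GL_total p * (1 + GL_ratio p)^2))"
      by (auto simp: GL_step_def fun_eq_iff)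
    have "GL_total p * (1 + GL_ratio p)^2 \<noteq> 0" if "p \<in> positive_params" for p
      using pos[OF that] by auto
    then show ?thesis
      unfolding eq by (intro continuous_intros ratio total) blast
  qed
  have "continuous_on positive_params (\<lambda>p.
      2 * (4 * (GL_ratio p)^2 + 3 * GL_ratio p + 1
        - GL_step p * GL_ratio p * (GL_ratio p + 1) * (2 * (GL_ratio p)^2 + 5 * GL_ratio p + 1))
      / ((2 * GL_ratio p + 1) * (GL_ratio p + 1)))"
    by (intro continuous_intros ratio step) (use pos in fastforce)
  then show ?thesis
    by (rule continuous_on_eq) (auto simp: positive_params_def CP_GL_J_minus_1)
qed

text \<open>Instability makes the value at most 0. A negative value would persist on a neighbourhood
  \<open>U\<close> free of stable parameters, against membership in the closure.\<close>

lemma CP_zero_if_GL_loses_stability: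
  assumes "GL_loses_stability p"
  shows "CP (GL_J p) (-1) = 0"
proof -
  have p: "p \<in> positive_params" "p \<in> closure GL_stable_region" "\<not> GL_locally_stable p"
    using assms by (auto simp: GL_loses_stability_def GL_stable_region_def frontier_def)
  then have "CP (GL_J p) (-1) \<le> 0"
    using GL_locally_stable_if_CP_pos by (cases p) (force simp: positive_params_def not_less)
  moreover have "\<not> CP (GL_J p) (-1) < 0"
  proof
    assume "CP (GL_J p) (-1) < 0"
    define U where "U = positive_params \<inter> (\<lambda>p. CP (GL_J p) (-1)) -` {..<0}"
    have "open U"
      unfolding U_def
      by (intro continuous_open_preimage continuous_on_CP_GL_J open_positive_params) simp
    moreover have "p \<in> U"
      using p(1) \<open>CP (GL_J p) (-1) < 0\<close> by (simp add: U_def)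
    ultimately obtain q where "q \<in> U" "q \<in> GL_stable_region"
      using p(2) open_Int_closure_eq_empty[of U GL_stable_region] by blast
    then show False
      using CP_nonneg_if_GL_locally_stable[of q] by (auto simp: U_def GL_stable_region_def)
  qed
  ultimately show ?thesis by simp
qed

theorem theorem2:
  fixes c1 c2 \<delta> :: real
  assumes "c1 > 0" and "c2 > 0" and "\<delta> > 0"
  shows "(\<exists>!x. positive_equilibrium (GL_map (c1, c2, \<delta>)) x)
    \<and> (R_GL1 (c1, c2, \<delta>) < 0 \<longrightarrow> GL_locally_stable (c1, c2, \<delta>))
    \<and> (GL_loses_stability (c1, c2, \<delta>) \<longrightarrow>
         CP (GL_J (c1, c2, \<delta>)) (-1) = 0
         \<and> CP (GL_J (c1, c2, \<delta>)) 1 \<noteq> 0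
         \<and> det (GL_J (c1, c2, \<delta>)) \<noteq> 1
         \<and> R_GL1 (c1, c2, \<delta>) = 0)"
proof (intro conjI impI)
  \<comment> \<open>The equilibrium is known in the coordinates \<open>k\<close> and
    \<open>s\<close>, so \<open>c1\<close> and \<open>c2\<close> are rewritten through them.\<close>
  show "\<exists>!x. positive_equilibrium (GL_map (c1, c2, \<delta>)) x"
    using positive_equilibrium_iff[OF GL_ratio_total(1,2)[OF assms(1,2)] assms(3)]
      GL_ratio_total(3,4)[OF assms(1,2)] by metis
next
  obtain A where R: "A \<ge> 0" "R_GL1 (c1, c2, \<delta>) = - A * CP (GL_J (c1, c2, \<delta>)) (-1)"
    using R_GL1_sign[OF assms] .
  {
    assume "R_GL1 (c1, c2, \<delta>) < 0"
    then have "A * CP (GL_J (c1, c2, \<delta>)) (-1) > 0" using R(2) by simp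
    then have "CP (GL_J (c1, c2, \<delta>)) (-1) > 0"
      using R(1) by (auto simp: zero_less_mult_iff)
    then show "GL_locally_stable (c1, c2, \<delta>)"
      by (rule GL_locally_stable_if_CP_pos[OF assms])
  next
    assume loss: "GL_loses_stability (c1, c2, \<delta>)"
    show CP: "CP (GL_J (c1, c2, \<delta>)) (-1) = 0"
      by (rule CP_zero_if_GL_loses_stability[OF loss])
    show "CP (GL_J (c1, c2, \<delta>)) 1 \<noteq> 0"
      using CP_GL_J_1_pos[OF assms] by simp
    show "det (GL_J (c1, c2, \<delta>)) \<noteq> 1"
      using det_GL_J_less_1[OF assms] CP by simp
    show "R_GL1 (c1, c2, \<delta>) = 0"
      using R(2) CP by simp
  }
qed

end
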